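(* Let $\mathcal{Q}$ be a finite classical polar space of rank $r\ge 1$, type $Q$ and parameter $\epsilon$ over $\mathbb{F}_q$, let $0\le t\le k\le r$, let $D$ be a $t$-$(r,k,\lambda)_Q$ design in $\mathcal{Q}$, and let $S$ be a subspace of $\mathcal{Q}$ of dimension $s=\dim(S)$. For $j\ge 0$ let $\alpha_j=\#\{B\in D\mid \dim(B\cap S)=j\}$. Then for every $i\in\{0,\ldots,t\}$, $$\sum_{j=i}^{s}\begin{bmatrix} j\\ i\end{bmatrix}_q\alpha_j=\begin{bmatrix} s\\ i\end{bmatrix}_q\lambda_i,\qquad\text{where}\quad \lambda_i=\lambda\cdot\frac{\begin{bmatrix} r-i\\ t-i\end{bmatrix}_Q}{\begin{bmatrix} k-i\\ t-i\end{bmatrix}_q}.$$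
   Context: Let $q$ be a prime power. A finite classical polar space $\mathcal{Q}$ over $\mathbb{F}_q$ consists of all subspaces of a finite-dimensional $\mathbb{F}_q$-vector space $V$, $n=\dim V$, that are totally isotropic (resp. totally singular) with respect to a non-degenerate alternating or Hermitian form (resp. a non-singular quadratic form) on $V$. All dimensions are vector space dimensions. The rank $r$ is the maximal dimension of a subspace in $\mathcal{Q}$. The type $Q$ of $\mathcal{Q}$ (kind of form together with $q$) and its parameter $\epsilon$ are: symplectic $\mathrm{Sp}(q)$ ($n=2r$, $\epsilon=0$); Hermitian $U^+(q)$ ($q$ a square, $n=2r$, $\epsilon=-1/2$); Hermitian $U^-(q)$ ($q$ a square, $n=2r+1$, $\epsilon=1/2$); hyperbolic $\Omega^+(q)$ ($n=2r$, $\epsilon=-1$); parabolic $\Omega(q)$ ($n=2r+1$, $\epsilon=0$); elliptic $\Omega^-(q)$ ($n=2r+2$, $\epsilon=1$). $\begin{bmatrix} m\\ k\end{bmatrix}_q$ is the Gaussian binomial coefficient (number of $k$-dimensional subspaces of $\mathbb{F}_q^m$, and $0$ if $k<0$ or $k>m$). $\begin{bmatrix} m\\ k\end{bmatrix}_Q=\begin{bmatrix} m\\ k\end{bmatrix}_q\prod_{i=m-k+1}^{m}(q^{i+\epsilon}+1)$ is the number of $k$-dimensional subspaces in a polar space of type $Q$ and rank $m$. For $t,k\in\{0,\ldots,r\}$ and an integer $\lambda\ge 0$, a $t$-$(r,k,\lambda)_Q$ design in $\mathcal{Q}$ is a set $D$ of $k$-dimensional subspaces of $\mathcal{Q}$ (called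 blocks) such that every $t$-dimensional subspace of $\mathcal{Q}$ is contained in exactly $\lambda$ elements of $D$. *)

theory Defs
  imports Complex_Main "HOL-Library.Cardinality"
begin

text \<open>
  The factors with \<open>i < k\<close> in the Gaussian binomial coefficient include \<open>i = m\<close> when \<open>k > m\<close>, so that
  the coefficient is then 0. The lemma \<open>card_subspaces_eq_gaussian_binomial\<close> below shows that it is the
  number of \<open>k\<close>-dimensional subspaces of an \<open>m\<close>-dimensional space.
\<close>
definition gaussian_binomial :: "nat \<Rightarrow> nat \<Rightarrow> nat \<Rightarrow> real" where
  "gaussian_binomial q m k = (\<Prod>i<k. (real q ^ (m - i) - 1) / (real q ^ (k - i) - 1))"

datatype polar_type =
    Symplectic | Hermitian_plus | Hermitian_minus | Hyperbolic | Parabolic | Elliptic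

fun type_eps :: "polar_type \<Rightarrow> real" where
  "type_eps Symplectic = 0"
| "type_eps Hermitian_plus = - 1 / 2"
| "type_eps Hermitian_minus = 1 / 2"
| "type_eps Hyperbolic = - 1"
| "type_eps Parabolic = 0"
| "type_eps Elliptic = 1"

fun ambient_dim :: "polar_type \<Rightarrow> nat \<Rightarrow> nat" where
  "ambient_dim Symplectic r = 2 * r"
| "ambient_dim Hermitian_plus r = 2 * r"
| "ambient_dim Hermitian_minus r = 2 * r + 1"
| "ambient_dim Hyperbolic r = 2 * r"
| "ambient_dim Parabolic r = 2 * r + 1"
| "ambient_dim Elliptic r = 2 * r + 2"

definition polar_binomial :: "polar_type \<Rightarrow> nat \<Rightarrow> nat \<Rightarrow> nat \<Rightarrow> real" where
  "polar_binomial Q q m k =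
     gaussian_binomial q m k * (\<Prod>i = m - k + 1..m. real q powr (real i + type_eps Q) + 1)"

locale finite_field_vector_space = vector_space scale
  for scale :: "'a::{field, finite} \<Rightarrow> 'b::ab_group_add \<Rightarrow> 'b"
begin

definition totally_isotropic_subspaces :: "('b \<Rightarrow> 'b \<Rightarrow> 'a) \<Rightarrow> 'b set set" where
  "totally_isotropic_subspaces f = {U. subspace U \<and> (\<forall>u\<in>U. \<forall>v\<in>U. f u v = 0)}"

definition totally_singular_subspaces :: "('b \<Rightarrow> 'a) \<Rightarrow> 'b set set" where
  "totally_singular_subspaces g = {U. subspace U \<and> (\<forall>u\<in>U. g u = 0)}"

definition nondegenerate :: "('b \<Rightarrow> 'b \<Rightarrow> 'a) \<Rightarrow> bool" where
  "nondegenerate f \<longleftrightarrow> (\<forall>u. (\<forall>v. f u v = 0) \<longrightarrow> u = 0)"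

definition bilinear_form :: "('b \<Rightarrow> 'b \<Rightarrow> 'a) \<Rightarrow> bool" where
  "bilinear_form f \<longleftrightarrow>
     (\<forall>u. Vector_Spaces.linear scale (*) (\<lambda>v. f u v)) \<and>
     (\<forall>v. Vector_Spaces.linear scale (*) (\<lambda>u. f u v))"

definition alternating_form :: "('b \<Rightarrow> 'b \<Rightarrow> 'a) \<Rightarrow> bool" where
  "alternating_form f \<longleftrightarrow> bilinear_form f \<and> (\<forall>v. f v v = 0)"

text \<open>
  Over a field of \<open>q\<^sub>0\<^sup>2\<close> elements the involutory automorphism is \<open>x \<mapsto> x ^ q\<^sub>0\<close>. Semilinearity
  in the second argument follows from the symmetry condition.
\<close>
definition hermitian_form :: "('b \<Rightarrow> 'b \<Rightarrow> 'a) \<Rightarrow> bool" where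
  "hermitian_form f \<longleftrightarrow>
     (\<exists>q\<^sub>0. q\<^sub>0 ^ 2 = CARD('a) \<and>
        (\<forall>v. Vector_Spaces.linear scale (*) (\<lambda>u. f u v)) \<and>
        (\<forall>u v. f v u = f u v ^ q\<^sub>0))"

definition polar_form :: "('b \<Rightarrow> 'a) \<Rightarrow> 'b \<Rightarrow> 'b \<Rightarrow> 'a" where
  "polar_form g u v = g (u + v) - g u - g v"

definition quadratic_form :: "('b \<Rightarrow> 'a) \<Rightarrow> bool" where
  "quadratic_form g \<longleftrightarrow>
     (\<forall>c v. g (scale c v) = c ^ 2 * g v) \<and> bilinear_form (polar_form g)"

text \<open>
  In characteristic 2 the polar form may have a radical (this always happens in odd dimension);
  only singular vectors in the radical are excluded.
\<close>
definition nonsingular :: "('b \<Rightarrow> 'a) \<Rightarrow> bool" where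
  "nonsingular g \<longleftrightarrow> (\<forall>u. g u = 0 \<and> (\<forall>v. polar_form g u v = 0) \<longrightarrow> u = 0)"

definition symplectic_polar_space :: "'b set set \<Rightarrow> bool" where
  "symplectic_polar_space P \<longleftrightarrow>
     (\<exists>f. alternating_form f \<and> nondegenerate f \<and> P = totally_isotropic_subspaces f)"

definition hermitian_polar_space :: "'b set set \<Rightarrow> bool" where
  "hermitian_polar_space P \<longleftrightarrow>
     (\<exists>f. hermitian_form f \<and> nondegenerate f \<and> P = totally_isotropic_subspaces f)"

definition orthogonal_polar_space :: "'b set set \<Rightarrow> bool" where
  "orthogonal_polar_space P \<longleftrightarrow>
     (\<exists>g. quadratic_form g \<and> nonsingular g \<and> P = totally_singular_subspaces g)"

fun polar_space_of_kind :: "polar_type \<Rightarrow> 'b set set \<Rightarrow> bool" where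
  "polar_space_of_kind Symplectic P = symplectic_polar_space P"
| "polar_space_of_kind Hermitian_plus P = hermitian_polar_space P"
| "polar_space_of_kind Hermitian_minus P = hermitian_polar_space P"
| "polar_space_of_kind Hyperbolic P = orthogonal_polar_space P"
| "polar_space_of_kind Parabolic P = orthogonal_polar_space P"
| "polar_space_of_kind Elliptic P = orthogonal_polar_space P"

definition polar_rank :: "'b set set \<Rightarrow> nat" where
  "polar_rank P = Max (dim ` P)"

definition polar_design :: "'b set set \<Rightarrow> nat \<Rightarrow> nat \<Rightarrow> nat \<Rightarrow> 'b set set \<Rightarrow> bool" where
  "polar_design P t k l D \<longleftrightarrow>
     t \<le> polar_rank P \<and> k \<le> polar_rank P \<and>
     D \<subseteq> {B \<in> P. dim B = k} \<and>
     (\<forall>U\<in>P. dim U = t \<longrightarrow> card {B \<in> D. U \<subseteq> B} = l)"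

end

text \<open>
  The kind of form does not determine the type of a Hermitian or orthogonal polar space; the
  relation between the rank and the dimension of the ambient space does.
\<close>
locale classical_polar_space = finite_dimensional_vector_space scale Basis + finite_field_vector_space scale
  for scale :: "'a::{field, finite} \<Rightarrow> 'v::ab_group_add \<Rightarrow> 'v" and Basis +
  fixes Q :: polar_type and r :: nat and P :: "'v set set"
  assumes kind: "polar_space_of_kind Q P"
    and rank: "polar_rank P = r"
    and dimension: "dim (UNIV :: 'v set) = ambient_dim Q r"


lemma card_subspaces_eq_gaussian_binomial:
  fixes scale :: "'a::{field, finite} \<Rightarrow> 'v::ab_group_add \<Rightarrow> 'v"
  assumes "finite_dimensional_vector_space scale Basis"
    and "module.subspace scale W"
  shows "real (card {U. module.subspace scale U \<and> U \<subseteq> W \<and> vector_space.dim scale U = k}) =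
    gaussian_binomial CARD('a) (vector_space.dim scale W) k"
proof -
  interpret finite_dimensional_vector_space scale Basis by fact
  define q where "q = CARD('a)"
  have q2: "q \<ge> 2"
  proof -
    have "card {0, 1 :: 'a} \<le> CARD('a)" by (rule card_mono) auto
    then show ?thesis by (simp add: q_def)
  qed
  have card_span_ind: "finite (span B) \<and> card (span B) = q ^ card B"
    if "finite B" "independent B" for B
    using that
  proof (induction B rule: finite_induct)
    case empty
    then show ?case by simp
  next
    case (insert a B)
    have a: "a \<notin> span B" and iB: "independent B"
      using insert by (auto simp: independent_insert)
    let ?f = "\<lambda>(c, v). scale c a + v"
    have eq: "span (insert a B) = ?f ` (UNIV \<times> span B)"
    proof (intro set_eqI iffI)
      fix x assume "x \<in> span (insert a B)"
      then obtain c where "x - scale c a \<in> span B" by (auto simp: span_insert)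
      then show "x \<in> ?f ` (UNIV \<times> span B)"
        by (intro image_eqI[of _ _ "(c, x - scale c a)"]) auto
    next
      fix x assume "x \<in> ?f ` (UNIV \<times> span B)"
      then obtain c v where "x = scale c a + v" "v \<in> span B" by auto
      then show "x \<in> span (insert a B)"
        by (auto simp: span_insert intro!: exI[of _ c])
    qed
    have inj: "inj_on ?f (UNIV \<times> span B)"
    proof (rule inj_onI, clarsimp)
      fix c v d w assume v: "v \<in> span B" "w \<in> span B" and e: "scale c a + v = scale d a + w"
      have "scale (c - d) a = w - v" using e by (simp add: algebra_simps)
      then have "scale (c - d) a \<in> span B" using v by (simp add: span_diff)
      then have "scale (inverse (c - d)) (scale (c - d) a) \<in> span B" by (rule span_scale)
      then have "c = d" using a by (cases "c = d") auto
      then show "c = d \<and> v = w" using e by auto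
    qed
    show ?case
      using insert.IH[OF iB] insert.hyps inj unfolding eq
      by (simp add: card_image card_cartesian_product q_def)
  qed
  have card_sub: "finite V \<and> card V = q ^ dim V" if V: "subspace V" for V
  proof -
    obtain B where B: "B \<subseteq> V" "independent B" "V \<subseteq> span B" "card B = dim V"
      using basis_exists by blast
    then have "span B = V" using V by (simp add: span_minimal subset_antisym)
    then show ?thesis using card_span_ind[OF finiteI_independent B(2)] B by simp
  qed
  define L where "L V k = {xs. length xs = k \<and> distinct xs \<and> independent (set xs) \<and> set xs \<subseteq> V}"
    for V :: "'v set" and k :: nat
  have card_L: "finite (L V k) \<and> real (card (L V k)) = (\<Prod>i<k. real q ^ dim V - real q ^ i)"
    if V: "subspace V" for V k
  proof (induction k)
    case 0
    have "L V 0 = {[]}" by (auto simp: L_def independent_empty)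
    then show ?case by simp
  next
    case (Suc k)
    have "x # xs \<in> L V (Suc k) \<longleftrightarrow> xs \<in> L V k \<and> x \<in> V - span (set xs)" for x xs
      using span_base[of x "set xs"] by (auto simp: L_def independent_insert)
    moreover have "\<exists>x ys. xs = x # ys" if "xs \<in> L V (Suc k)" for xs
      using that by (auto simp: L_def length_Suc_conv)
    ultimately have eq: "L V (Suc k) = (\<lambda>(xs, x). x # xs) ` (SIGMA xs:L V k. V - span (set xs))"
      (is "_ = ?g ` ?S")
      by fastforce
    have c: "finite (V - span (set xs)) \<and> card (V - span (set xs)) = q ^ dim V - q ^ k"
      if "xs \<in> L V k" for xs
    proof -
      have s: "span (set xs) \<subseteq> V" using that V by (simp add: L_def span_minimal)
      have "card (span (set xs)) = q ^ k"
        using that card_span_ind[of "set xs"] by (auto simp: L_def distinct_card)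
      then show ?thesis
        using card_sub[OF V] s finite_subset[OF s] by (simp add: card_Diff_subset)
    qed
    have inj: "inj_on ?g ?S" by (auto simp: inj_on_def)
    have fin: "finite (L V (Suc k))"
      unfolding eq using Suc c by (intro finite_imageI finite_SigmaI) auto
    have "card (L V (Suc k)) = (\<Sum>xs\<in>L V k. card (V - span (set xs)))"
      unfolding eq using inj Suc c by (simp add: card_image card_SigmaI)
    also have "\<dots> = card (L V k) * (q ^ dim V - q ^ k)" using c by simp
    finally have e: "card (L V (Suc k)) = card (L V k) * (q ^ dim V - q ^ k)" .
    show ?case
    proof (cases "L V k = {}")
      case True
      then have "(\<Prod>i<k. real q ^ dim V - real q ^ i) = 0" using Suc by auto
      then have "(\<Prod>i<Suc k. real q ^ dim V - real q ^ i) = 0" by simp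
      then show ?thesis using e fin True by simp
    next
      case False
      then obtain xs where xs: "xs \<in> L V k" by auto
      then have "dim V \<ge> k"
        using independent_card_le_dim[of "set xs" V] by (auto simp: L_def distinct_card)
      then have "q ^ k \<le> q ^ dim V" using q2 by (intro power_increasing) auto
      then show ?thesis using e fin Suc by (simp add: of_nat_diff)
    qed
  qed
  define G where "G = {U. subspace U \<and> U \<subseteq> W \<and> dim U = k}"
  have finW: "finite W" using card_sub assms(2) by blast
  have finG: "finite G"
    by (rule finite_subset[of _ "Pow W"]) (auto simp: G_def finW)
  have part: "L W k = (\<Union>U\<in>G. L U k)"
  proof (intro set_eqI iffI)
    fix xs assume xs: "xs \<in> L W k"
    then have "span (set xs) \<in> G"
      using assms(2) by (auto simp: G_def L_def span_minimal dim_span_eq_card_independent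
          distinct_card dim_eq_card_independent)
    moreover have "xs \<in> L (span (set xs)) k" using xs by (auto simp: L_def span_base)
    ultimately show "xs \<in> (\<Union>U\<in>G. L U k)" by blast
  qed (auto simp: L_def G_def)
  have sp: "span (set xs) = U" if "xs \<in> L U k" "U \<in> G" for xs U
  proof (rule subspace_dim_equal)
    show "span (set xs) \<subseteq> U" using that by (auto simp: L_def G_def intro: span_minimal[THEN subsetD])
    show "dim U \<le> dim (span (set xs))"
      using that by (simp add: L_def G_def dim_eq_card_independent distinct_card)
  qed (use that in \<open>auto simp: G_def\<close>)
  have "card (L W k) = (\<Sum>U\<in>G. card (L U k))"
    unfolding part
  proof (rule card_UN_disjoint[OF finG])
    show "\<forall>U\<in>G. finite (L U k)" using card_L by (auto simp: G_def)
    show "\<forall>U\<in>G. \<forall>V\<in>G. U \<noteq> V \<longrightarrow> L U k \<inter> L V k = {}" using sp by blast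
  qed
  then have "real (card (L W k)) = (\<Sum>U\<in>G. real (card (L U k)))" by simp
  also have "\<dots> = (\<Sum>U\<in>G. \<Prod>i<k. real q ^ k - real q ^ i)"
    using card_L by (intro sum.cong) (auto simp: G_def)
  finally have main: "real (card G) * (\<Prod>i<k. real q ^ k - real q ^ i) =
      (\<Prod>i<k. real q ^ dim W - real q ^ i)"
    using card_L[OF assms(2)] by simp
  have pos: "(\<Prod>i<k. real q ^ k - real q ^ i) \<noteq> 0"
  proof -
    have "real q ^ k - real q ^ i \<noteq> 0" if "i < k" for i
      using power_strict_increasing[of i k "real q"] that q2 by linarith
    then show ?thesis unfolding prod_zero_iff[OF finite_lessThan] by blast
  qed
  have "(\<Prod>i<k. real q ^ dim W - real q ^ i) / (\<Prod>i<k. real q ^ k - real q ^ i) =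
      gaussian_binomial q (dim W) k"
  proof (cases "k \<le> dim W")
    case True
    have "(real q ^ dim W - real q ^ i) / (real q ^ k - real q ^ i) =
        (real q ^ (dim W - i) - 1) / (real q ^ (k - i) - 1)" if "i < k" for i
    proof -
      have s: "real q ^ m - real q ^ i = real q ^ i * (real q ^ (m - i) - 1)" if "i \<le> m" for m
        using that by (simp add: right_diff_distrib flip: power_add)
      have "i \<le> dim W" "i \<le> k" using that True by auto
      moreover have "real q ^ i \<noteq> 0" using q2 by simp
      ultimately show ?thesis
        by (simp only: s mult_divide_mult_cancel_left not_False_eq_True)
    qed
    then show ?thesis
      unfolding gaussian_binomial_def prod_dividef[symmetric] by (intro prod.cong) auto
  next
    case False
    then have "(\<Prod>i<k. real q ^ dim W - real q ^ i) = 0"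
      by (auto intro!: bexI[of _ "dim W"])
    moreover have "gaussian_binomial q (dim W) k = 0"
      using False by (auto simp: gaussian_binomial_def intro!: bexI[of _ "dim W"])
    ultimately show ?thesis by simp
  qed
  moreover have "real (card G) =
      (\<Prod>i<k. real q ^ dim W - real q ^ i) / (\<Prod>i<k. real q ^ k - real q ^ i)"
    unfolding main[symmetric] using pos by (rule nonzero_mult_div_cancel_right[symmetric])
  ultimately show ?thesis
    unfolding G_def q_def by (rule trans[rotated])
qed

end

theory Submission
  imports Defs "HOL-Computational_Algebra.Polynomial"
begin

text \<open>
  Counting the pairs \<open>(I, B)\<close> with \<open>B \<in> D\<close>, \<open>I \<subseteq> B \<inter> S\<close> and \<open>dim I = i\<close> in two ways reduces the
  identity to the claim that every \<open>i\<close>-dimensional \<open>I\<close> in the polar space lies in exactly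
  \<open>\<lambda>\<^sub>i\<close> blocks. Counting the pairs \<open>I \<subseteq> T \<subseteq> B\<close> with \<open>dim T = t\<close> reduces this in turn to the number
  of \<open>t\<close>-dimensional subspaces of the polar space above \<open>I\<close>.

  For that number only the singular vectors orthogonal to a subspace \<open>U\<close> of the polar space need to
  be counted. Let \<open>q\<close> be the order of the field and \<open>n\<close> the dimension of the ambient space. If \<open>x\<close> is
  singular and \<open>v\<close> is not orthogonal to \<open>x\<close>, then the line \<open>v + \<langle>x\<rangle>\<close> contains a constant number \<open>c\<close>
  of singular vectors (\<open>q\<close> in the symplectic, \<open>\<surd>q\<close> in the Hermitian and \<open>1\<close> in the orthogonal
  case). Therefore the number of singular vectors in the orthogonal complement of \<open>U\<close>, minus
  \<open>c q\<^sup>n / q\<^bsup>dim U + 1\<^esup>\<close>, does not change when \<open>U\<close> is enlarged inside the polar space. For \<open>U\<close> of maximal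
  dimension \<open>r\<close> the singular vectors in the complement are those of \<open>U\<close> itself, so the invariant is
  known. Neither Witt's theorem nor the classification of forms is needed.
\<close>

section \<open>Subspaces over a finite field\<close>

locale finite_vector_space =
  finite_dimensional_vector_space scale Basis + finite_field_vector_space scale
  for scale :: "'a::{field, finite} \<Rightarrow> 'v::ab_group_add \<Rightarrow> 'v" and Basis
begin

lemma card_field_ge_2: "CARD('a) \<ge> 2"
proof -
  have "card {0, 1 :: 'a} \<le> CARD('a)" by (rule card_mono) auto
  then show ?thesis by simp
qed

lemma finite_card_span:
  assumes "independent B"
  shows "finite (span B) \<and> card (span B) = CARD('a) ^ card B"
  using finiteI_independent[OF assms] assms
proof (induction B rule: finite_induct)
  case empty
  then show ?case by simp
next
  case (insert a B)
  have a: "a \<notin> span B" and B: "independent B"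
    using insert by (auto simp: independent_insert)
  let ?f = "\<lambda>(c, v). scale c a + v"
  have "bij_betw ?f (UNIV \<times> span B) (span (insert a B))"
  proof (rule bij_betw_imageI)
    show "inj_on ?f (UNIV \<times> span B)"
    proof (rule inj_onI, clarsimp)
      fix c v d w
      assume v: "v \<in> span B" "w \<in> span B" and e: "scale c a + v = scale d a + w"
      have "scale (c - d) a = w - v" using e by (simp add: algebra_simps)
      then have "scale (c - d) a \<in> span B" using v by (simp add: span_diff)
      then have "scale (inverse (c - d)) (scale (c - d) a) \<in> span B" by (rule span_scale)
      then have "c = d" using a by (cases "c = d") auto
      then show "c = d \<and> v = w" using e by auto
    qed
    have "x \<in> ?f ` (UNIV \<times> span B) \<longleftrightarrow> (\<exists>c. x - scale c a \<in> span B)" for x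
    proof
      assume "\<exists>c. x - scale c a \<in> span B"
      then obtain c where "x - scale c a \<in> span B" ..
      then show "x \<in> ?f ` (UNIV \<times> span B)"
        by (intro image_eqI[of _ _ "(c, x - scale c a)"]) auto
    next
      assume "x \<in> ?f ` (UNIV \<times> span B)"
      then obtain c v where "x = scale c a + v" "v \<in> span B" by auto
      then show "\<exists>c. x - scale c a \<in> span B" by (intro exI[of _ c]) simp
    qed
    then show "?f ` (UNIV \<times> span B) = span (insert a B)"
      unfolding span_insert by blast
  qed
  from bij_betw_same_card[OF this] bij_betw_finite[OF this] show ?case
    using insert.IH[OF B] insert.hyps by (simp add: card_cartesian_product)
qed

lemma finite_vectors: "finite (A :: 'v set)"
  using finite_card_span[OF independent_Basis] span_Basis
  by (metis finite_subset subset_UNIV)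

lemma card_subspace:
  assumes "subspace U"
  shows "card U = CARD('a) ^ dim U"
proof -
  obtain B where B: "B \<subseteq> U" "independent B" "U \<subseteq> span B" "card B = dim U"
    using basis_exists by blast
  then have "span B = U" using assms by (simp add: span_minimal subset_antisym)
  then show ?thesis using finite_card_span[OF B(2)] B by simp
qed

lemma finite_sets [simp]: "finite (F :: 'v set set)"
  using finite_vectors[of UNIV] by (metis Finite_Set.finite_set finite_subset subset_UNIV)

lemma dim_span_insert:
  assumes "subspace U" "v \<notin> U"
  shows "dim (span (insert v U)) = Suc (dim U)"
  using assms by (simp add: dim_insert span_eq_iff[THEN iffD2])

text \<open>
  Downward induction on \<open>dim I\<close>: count the pairs \<open>(v, T)\<close> with \<open>v \<in> T - I\<close>, grouping them first by
  \<open>T\<close> and then by the span of \<open>v\<close> and \<open>I\<close>.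
\<close>
lemma card_superspaces:
  fixes a :: "nat \<Rightarrow> real"
  assumes sub: "\<And>U. U \<in> F \<Longrightarrow> subspace U"
    and down: "\<And>U T. T \<in> F \<Longrightarrow> subspace U \<Longrightarrow> U \<subseteq> T \<Longrightarrow> U \<in> F"
    and ext: "\<And>U. U \<in> F \<Longrightarrow> real (card {v. v \<notin> U \<and> span (insert v U) \<in> F}) = a (dim U)"
    and "I \<in> F" "dim I \<le> t"
  shows "real (card {T \<in> F. I \<subseteq> T \<and> dim T = t}) =
    (\<Prod>u = dim I..<t. a u / (real CARD('a) ^ t - real CARD('a) ^ u))"
  using assms(4,5)
proof (induction "t - dim I" arbitrary: I)
  case 0
  then have "{T \<in> F. I \<subseteq> T \<and> dim T = t} = {I}"
    using sub by (auto dest: subspace_dim_equal[rotated 2, OF _ ])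
  then show ?case using 0 by simp
next
  case (Suc n)
  have I: "subspace I" "dim I < t" using Suc sub by auto
  let ?A = "\<lambda>I. {T \<in> F. I \<subseteq> T \<and> dim T = t}"
  let ?E = "{v. v \<notin> I \<and> span (insert v I) \<in> F}"
  have lt: "real CARD('a) ^ dim I < real CARD('a) ^ t"
    using I(2) card_field_ge_2 by (intro power_strict_increasing) auto
  have "card {v \<in> ?E. v \<in> T} = CARD('a) ^ t - CARD('a) ^ dim I" if "T \<in> ?A I" for T
  proof -
    have T: "subspace T" "I \<subseteq> T" "dim T = t" "T \<in> F" using that sub by auto
    have "span (insert v I) \<in> F" if "v \<in> T" for v
      by (rule down[OF T(4) subspace_span span_minimal]) (use T that in auto)
    then have "{v \<in> ?E. v \<in> T} = T - I" by auto
    then show ?thesis using T I by (simp add: card_Diff_subset finite_vectors card_subspace)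
  qed
  then have "(\<Sum>v\<in>?E. card {T \<in> ?A I. v \<in> T}) = (\<Sum>T\<in>?A I. CARD('a) ^ t - CARD('a) ^ dim I)"
    by (intro sum_multicount_gen) (auto simp: finite_vectors)
  then have eq: "real (\<Sum>v\<in>?E. card {T \<in> ?A I. v \<in> T}) = real (\<Sum>T\<in>?A I. CARD('a) ^ t - CARD('a) ^ dim I)"
    by presburger
  have "real (card {T \<in> ?A I. v \<in> T}) = (\<Prod>u = Suc (dim I)..<t. a u / (real CARD('a) ^ t - real CARD('a) ^ u))"
    if v: "v \<in> ?E" for v
  proof -
    have d: "dim (span (insert v I)) = Suc (dim I)"
      using v I by (intro dim_span_insert) auto
    have "span (insert v I) \<subseteq> T \<longleftrightarrow> I \<subseteq> T \<and> v \<in> T" if "T \<in> F" for T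
      using sub[OF that] span_superset[of "insert v I"] span_minimal[of "insert v I" T] by auto
    then have "{T \<in> ?A I. v \<in> T} = ?A (span (insert v I))" by auto
    then show ?thesis
      using Suc.hyps(1)[of "span (insert v I)"] Suc.hyps(2) I v unfolding d by simp
  qed
  then have "real (\<Sum>v\<in>?E. card {T \<in> ?A I. v \<in> T}) =
      a (dim I) * (\<Prod>u = Suc (dim I)..<t. a u / (real CARD('a) ^ t - real CARD('a) ^ u))"
    using ext[OF Suc.prems(1)] by simp
  moreover have "real (\<Sum>T\<in>?A I. CARD('a) ^ t - CARD('a) ^ dim I) =
      real (card (?A I)) * (real CARD('a) ^ t - real CARD('a) ^ dim I)"
    using lt by (simp add: of_nat_diff power_increasing_iff flip: of_nat_power)
  ultimately have "real (card (?A I)) * (real CARD('a) ^ t - real CARD('a) ^ dim I) =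
      a (dim I) * (\<Prod>u = Suc (dim I)..<t. a u / (real CARD('a) ^ t - real CARD('a) ^ u))"
    using eq by presburger
  then show ?case
    using lt I(2) by (simp add: prod.atLeast_Suc_lessThan field_simps)
qed

end

section \<open>Singular vectors of reflexive forms\<close>

text \<open>
  \<open>X\<close> is the set of singular vectors. The form \<open>f\<close> is only assumed to be linear on the left, so
  that Hermitian forms fit without showing that the field automorphism is additive. For quadratic
  forms \<open>f\<close> is the polar form, which in characteristic 2 may have a non-zero radical.
\<close>
locale reflexive_form = finite_vector_space scale Basis
  for scale :: "'a::{field, finite} \<Rightarrow> 'v::ab_group_add \<Rightarrow> 'v" and Basis +
  fixes f :: "'v \<Rightarrow> 'v \<Rightarrow> 'a" and X :: "'v set" and c :: nat
  assumes linear_left: "Vector_Spaces.linear scale (*) (\<lambda>u. f u v)"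
    and reflexive: "f u v = 0 \<Longrightarrow> f v u = 0"
    and singular_self: "v \<in> X \<Longrightarrow> f v v = 0"
    and singular_zero: "0 \<in> X"
    and singular_scale: "v \<in> X \<Longrightarrow> scale k v \<in> X"
    and singular_add: "u \<in> X \<Longrightarrow> v \<in> X \<Longrightarrow> f u v = 0 \<Longrightarrow> u + v \<in> X"
    and singular_radical: "v \<in> X \<Longrightarrow> (\<And>w. f v w = 0) \<Longrightarrow> v = 0"
    and card_singular_on_line: "x \<in> X \<Longrightarrow> f v x \<noteq> 0 \<Longrightarrow> card {k. v + scale k x \<in> X} = c"
begin

definition polar :: "'v set set" where
  "polar = {U. subspace U \<and> U \<subseteq> X \<and> (\<forall>u\<in>U. \<forall>v\<in>U. f u v = 0)}"

text \<open>The varying vector stands on the left, where \<open>f\<close> is linear, so that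
  \<open>orth A\<close> is a subspace for every set \<open>A\<close>.\<close>

definition orth :: "'v set \<Rightarrow> 'v set" where
  "orth A = {v. \<forall>a\<in>A. f v a = 0}"

lemma form_add: "f (u + v) w = f u w + f v w"
  and form_scale: "f (scale k v) w = k * f v w"
  using linear_left[of w] unfolding Vector_Spaces.linear_iff by auto

lemma form_zero [simp]: "f 0 w = 0" "f w 0 = 0"
proof -
  show "f 0 w = 0" using form_scale[of 0 0 w] by simp
  then show "f w 0 = 0" by (rule reflexive)
qed

lemma subspace_orth: "subspace (orth A)"
  by (rule subspaceI) (auto simp: orth_def form_add form_scale)

lemma orth_antimono: "A \<subseteq> B \<Longrightarrow> orth B \<subseteq> orth A"
  by (auto simp: orth_def)

lemma subset_orth_sym: "A \<subseteq> orth B \<Longrightarrow> B \<subseteq> orth A"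
  unfolding orth_def using reflexive by blast

text \<open>Since \<open>f\<close> is linear only on the left, the span is reached by duality: by
  reflexivity \<open>A\<close> lies in \<open>orth (orth A)\<close>, which as a subspace contains
  \<open>span A\<close> too.\<close>

lemma orth_span: "orth (span A) = orth A"
proof
  have "A \<subseteq> orth (orth A)" by (rule subset_orth_sym) simp
  then have "span A \<subseteq> orth (orth A)" by (rule span_minimal) (rule subspace_orth)
  then show "orth A \<subseteq> orth (span A)" by (rule subset_orth_sym)
qed (rule orth_antimono, rule span_superset)

text \<open>Inside \<open>orth A\<close>, the smaller complement is the kernel of the linear
  functional sending \<open>v\<close> to \<open>f v x\<close>, hence has codimension at most
  one.\<close>

lemma dim_orth_insert: "dim (orth A) \<le> Suc (dim (orth (insert x A)))"
proof (cases "orth A \<subseteq> orth (insert x A)")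
  case True
  then show ?thesis using dim_subset[OF True] by simp
next
  case False
  then obtain s where s: "s \<in> orth A" "f s x \<noteq> 0" by (auto simp: orth_def)
  have "v \<in> span (insert s (orth (insert x A)))" if v: "v \<in> orth A" for v
  proof -
    let ?w = "v + scale (- (f v x / f s x)) s"
    have "?w \<in> orth (insert x A)"
      using v s by (auto simp: orth_def form_add form_scale simp del: scale_minus_left)
    then have "?w + scale (f v x / f s x) s \<in> span (insert s (orth (insert x A)))"
      by (intro span_add span_scale span_base) auto
    then show ?thesis by simp
  qed
  then have "dim (orth A) \<le> dim (insert s (orth (insert x A)))" by (intro dim_mono) auto
  also have "\<dots> \<le> Suc (dim (orth (insert x A)))" by (simp add: dim_insert)
  finally show ?thesis .
qed

lemma dim_orth_Un:
  assumes "finite C"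
  shows "dim (orth A) \<le> dim (orth (A \<union> C)) + card C"
  using assms
proof (induction C rule: finite_induct)
  case empty
  then show ?case by simp
next
  case (insert x C)
  then show ?case using dim_orth_insert[of "A \<union> C" x] by simp
qed

lemma polarD:
  assumes "U \<in> polar"
  shows "subspace U" "U \<subseteq> X" "U \<subseteq> orth U"
  using assms by (auto simp: polar_def orth_def)

lemma polar_subspace: "T \<in> polar \<Longrightarrow> subspace U \<Longrightarrow> U \<subseteq> T \<Longrightarrow> U \<in> polar"
  by (auto simp: polar_def)

lemma zero_in_polar: "{0} \<in> polar"
  by (auto simp: polar_def singular_zero subspace_single_0)

text \<open>
  Adding a vector to \<open>A\<close> lowers the dimension of \<open>orth A\<close> by at most one. For the upper bound choose
  \<open>C\<close> of minimal size such that \<open>U\<close>, \<open>C\<close> and the radical \<open>orth UNIV\<close> span the whole space. Then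
  \<open>orth (U \<union> C)\<close> is the radical, and adding \<open>C\<close> reduces \<open>orth U\<close> to the radical only if \<open>orth U\<close> is small.
\<close>
lemma dim_orth:
  assumes U: "U \<in> polar"
  shows "dim (orth U) + dim U = dim (UNIV :: 'v set)"
proof (rule antisym)
  note sU = polarD(1)[OF U]
  obtain B where B: "B \<subseteq> U" "independent B" "U \<subseteq> span B" "card B = dim U"
    using basis_exists by blast
  then have "span B = U" using sU by (simp add: span_minimal subset_antisym)
  then have "orth B = orth U" using orth_span[of B] by simp
  then show "dim (UNIV :: 'v set) \<le> dim (orth U) + dim U"
    using dim_orth_Un[OF finite_vectors, of "{}" B] B(4) by (simp add: orth_def)
next
  note sU = polarD(1)[OF U]
  let ?R = "orth UNIV"
  let ?S = "{x + y |x y. x \<in> U \<and> y \<in> ?R}"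
  have "U \<inter> ?R = {0}"
    using singular_radical polarD(2)[OF U] subspace_0[OF sU] by (auto simp: orth_def)
  then have S: "dim ?S = dim U + dim ?R"
    using dim_sums_Int[OF sU subspace_orth[of UNIV]] by simp
  obtain B where B: "B \<subseteq> ?S" "independent B" "?S \<subseteq> span B" "card B = dim ?S"
    using basis_exists by blast
  define C where "C = extend_basis B - B"
  have ext: "B \<subseteq> extend_basis B" "independent (extend_basis B)" "span (extend_basis B) = UNIV"
    using B(2) extend_basis_superset independent_extend_basis span_extend_basis by auto
  have "card (extend_basis B) = dim (UNIV :: 'v set)"
    by (rule basis_card_eq_dim) (use ext in auto)
  then have C: "card C + dim U + dim ?R = dim (UNIV :: 'v set)"
    using S B(4) card_Diff_subset[OF finite_vectors ext(1)] card_mono[OF finite_vectors ext(1)]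
    by (simp add: C_def)
  have "orth (U \<union> C) \<subseteq> ?R"
  proof
    fix v assume v: "v \<in> orth (U \<union> C)"
    have vs: "U \<union> C \<subseteq> orth {v}"
      using v reflexive by (auto simp: orth_def)
    have "?R \<subseteq> orth {v}" by (auto simp: orth_def)
    then have "?S \<subseteq> orth {v}"
      using vs subspace_add[OF subspace_orth] by auto blast
    then have "extend_basis B \<subseteq> orth {v}" using vs B(1) unfolding C_def by blast
    then have "span (extend_basis B) \<subseteq> orth {v}" by (intro span_minimal subspace_orth)
    then show "v \<in> ?R" unfolding ext(3) using subset_orth_sym by blast
  qed
  then have "dim (orth (U \<union> C)) \<le> dim ?R" by (rule dim_subset)
  then show "dim (orth U) + dim U \<le> dim (UNIV :: 'v set)"
    using dim_orth_Un[OF finite_vectors, of U C] C by simp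
qed

text \<open>Every vector of the span is a multiple of \<open>v\<close> plus an element of
  \<open>U\<close>; these are singular and orthogonal, so their sum is singular. Counting one-step
  extensions of \<open>U\<close> thus becomes counting singular vectors in
  \<open>orth U\<close>.\<close>

lemma span_insert_in_polar_iff:
  assumes U: "U \<in> polar"
  shows "span (insert v U) \<in> polar \<longleftrightarrow> v \<in> X \<inter> orth U"
proof
  assume "span (insert v U) \<in> polar"
  then show "v \<in> X \<inter> orth U"
    using span_superset[of "insert v U"] by (auto simp: polar_def orth_def)
next
  assume v: "v \<in> X \<inter> orth U"
  note sU = polarD[OF U]
  have "y \<in> X" if "y \<in> span (insert v U)" for y
  proof -
    obtain k where k: "y - scale k v \<in> U"
      using \<open>y \<in> _\<close> sU(1) by (auto simp: span_insert span_eq_iff[THEN iffD2])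
    have "scale k v + (y - scale k v) \<in> X"
      using k v sU(2) by (intro singular_add singular_scale) (auto simp: form_scale orth_def)
    then show ?thesis by simp
  qed
  moreover have "span (insert v U) \<subseteq> orth (span (insert v U))"
    unfolding orth_span
  proof (rule span_minimal[OF _ subspace_orth])
    have "f v v = 0" "U \<subseteq> orth {v}"
      using v singular_self reflexive by (auto simp: orth_def)
    then show "insert v U \<subseteq> orth (insert v U)"
      using v sU(3) by (auto simp: orth_def)
  qed
  ultimately show "span (insert v U) \<in> polar"
    by (auto simp: polar_def orth_def)
qed

text \<open>Count the pairs \<open>(k, v)\<close> with \<open>v\<close> in \<open>W\<close> and
  \<open>v + scale k x\<close> in \<open>X\<close>. Translation by \<open>scale k x\<close> permutes
  \<open>W\<close>, so each \<open>k\<close> gives \<open>card (X \<inter> W)\<close> pairs, while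
  each \<open>v\<close> gives \<open>c\<close>.\<close>

lemma card_singular_translates:
  assumes "x \<in> X" and W: "\<And>v k. v \<in> W \<Longrightarrow> v + scale k x \<in> W" and "\<And>v. v \<in> W \<Longrightarrow> f v x \<noteq> 0"
  shows "CARD('a) * card (X \<inter> W) = c * card W"
proof -
  have "(\<Sum>k\<in>UNIV. card {v \<in> W. v + scale k x \<in> X}) = (\<Sum>v\<in>W. c)"
    using assms card_singular_on_line
    by (intro sum_multicount_gen) (auto simp: finite_vectors)
  moreover have "card {v \<in> W. v + scale k x \<in> X} = card (X \<inter> W)" for k
  proof (rule bij_betw_same_card[of "\<lambda>v. v + scale k x"])
    show "bij_betw (\<lambda>v. v + scale k x) {v \<in> W. v + scale k x \<in> X} (X \<inter> W)"
      by (rule bij_betw_byWitness[where f' = "\<lambda>v. v - scale k x"])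
        (use W W[of _ "- k"] in auto)
  qed
  ultimately show ?thesis by simp
qed

text \<open>For \<open>U\<close> in \<open>polar\<close> the subtracted term is \<open>c\<close>
  times \<open>card (orth U)\<close> divided by the order of the field: the count that would result
  if every line contained \<open>c\<close> singular vectors.\<close>

definition excess :: "'v set \<Rightarrow> real" where
  "excess U = real (card (X \<inter> orth U)) -
     real c * real CARD('a) ^ dim (UNIV :: 'v set) / real CARD('a) ^ Suc (dim U)"

text \<open>The vectors lost from \<open>orth U\<close> are those not orthogonal to
  \<open>x\<close>. They form full lines in direction \<open>x\<close>, so the singular ones among
  them number exactly the drop in the subtracted term.\<close>

lemma excess_span_insert:
  assumes U: "U \<in> polar" and x: "x \<in> X \<inter> orth U" "x \<notin> U"
  shows "excess (span (insert x U)) = excess U"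
proof -
  let ?T = "span (insert x U)" and ?q = "real CARD('a)" and ?n = "dim (UNIV :: 'v set)"
  have T: "?T \<in> polar" using U x by (simp add: span_insert_in_polar_iff)
  have d: "dim ?T = Suc (dim U)" using dim_span_insert polarD(1)[OF U] x(2) .
  have oT: "orth ?T = orth U \<inter> {v. f v x = 0}" unfolding orth_span by (auto simp: orth_def)
  have xx: "f x x = 0" using x singular_self by auto
  let ?W = "orth U - orth ?T"
  have "CARD('a) * card (X \<inter> ?W) = c * card ?W"
  proof (rule card_singular_translates)
    show "v + scale k x \<in> ?W" if "v \<in> ?W" for v k
      using that x xx unfolding oT by (auto simp: orth_def form_add form_scale)
  qed (use x oT in auto)
  then have "?q * card (X \<inter> ?W) = c * real (card ?W)"
    by (simp flip: of_nat_mult)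
  moreover have "real (card ?W) = real (card (orth U)) - real (card (orth ?T))"
    using card_mono[of "orth U" "orth ?T"]
    by (simp add: oT card_Diff_subset finite_vectors of_nat_diff)
  ultimately have K: "real (card (X \<inter> ?W)) = c * (card (orth U) - real (card (orth ?T))) / ?q"
    by (simp add: field_simps)
  have oU: "real (card (orth U)) = ?q ^ ?n / ?q ^ dim U"
    using dim_orth[OF U, symmetric] by (simp add: card_subspace subspace_orth power_add)
  have oT': "real (card (orth ?T)) = ?q ^ ?n / ?q ^ Suc (dim U)"
    using dim_orth[OF T, symmetric] unfolding d
    by (simp add: card_subspace subspace_orth power_add)
  have "card (X \<inter> orth U) = card (X \<inter> orth ?T) + card (X \<inter> ?W)"
    using oT by (subst card_Un_disjoint[symmetric]) (auto simp: finite_vectors intro: arg_cong[of _ _ card])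
  then have Z: "real (card (X \<inter> orth U)) =
      real (card (X \<inter> orth ?T)) + real (card (X \<inter> ?W))" by simp
  show ?thesis
    unfolding excess_def d Z K oU oT' by (simp add: algebra_simps diff_divide_distrib)
qed

lemma excess_eq:
  assumes "U \<in> polar" "T \<in> polar" "U \<subseteq> T"
  shows "excess U = excess T"
  using assms
proof (induction "dim T - dim U" arbitrary: U)
  case 0
  then have "U = T" by (intro subspace_dim_equal polarD) auto
  then show ?case by simp
next
  case (Suc n)
  then have "U \<noteq> T" by auto
  with Suc.prems obtain x where x: "x \<in> T" "x \<notin> U" by blast
  have xo: "x \<in> X \<inter> orth U"
    using x Suc.prems by (auto simp: polar_def orth_def)
  let ?U = "span (insert x U)"
  have "dim ?U = Suc (dim U)"
    using dim_span_insert polarD(1) Suc.prems(1) x(2) .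
  moreover have "?U \<in> polar" using Suc.prems(1) xo by (simp add: span_insert_in_polar_iff)
  moreover have "?U \<subseteq> T"
    using x Suc.prems by (intro span_minimal polarD) auto
  ultimately have "excess ?U = excess T" using Suc by simp
  then show ?case using excess_span_insert[OF Suc.prems(1) xo x(2)] by simp
qed

lemma card_extensions:
  assumes U: "U \<in> polar" and r: "polar_rank polar = r"
  shows "real (card {v. v \<notin> U \<and> span (insert v U) \<in> polar}) =
    real CARD('a) ^ r - real CARD('a) ^ dim U +
    real c * real CARD('a) ^ dim (UNIV :: 'v set) *
      (1 / real CARD('a) ^ Suc (dim U) - 1 / real CARD('a) ^ Suc r)"
proof -
  have "Max (dim ` polar) \<in> dim ` polar"
    by (rule Max_in) (use zero_in_polar in auto)
  then have "r \<in> dim ` polar" using r by (simp add: polar_rank_def)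
  then obtain R where R: "R \<in> polar" "dim R = r" by blast
  \<comment> \<open>A singular vector of \<open>orth R\<close> outside \<open>R\<close> would extend
    \<open>R\<close> beyond the maximal dimension \<open>r\<close>.\<close>
  have "X \<inter> orth R \<subseteq> R"
  proof
    fix x assume x: "x \<in> X \<inter> orth R"
    then have "span (insert x R) \<in> polar" using R by (simp add: span_insert_in_polar_iff)
    from imageI[OF this, of dim] have "dim (span (insert x R)) \<le> r"
      unfolding r[symmetric] polar_rank_def by (intro Max_ge) simp
    then show "x \<in> R" using dim_span_insert[OF polarD(1)[OF R(1)]] R(2) by fastforce
  qed
  then have "X \<inter> orth R = R" using polarD[OF R(1)] by auto
  then have "excess R = real CARD('a) ^ r -
      real c * real CARD('a) ^ dim (UNIV :: 'v set) / real CARD('a) ^ Suc r"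
    unfolding excess_def using R polarD(1) by (simp add: card_subspace)
  \<comment> \<open>\<open>U\<close> and \<open>R\<close> need not be comparable, but both contain
    \<open>{0}\<close>, through which the invariant is transported.\<close>
  moreover have "excess U = excess R"
    using excess_eq[OF zero_in_polar _ ] U R polarD(1) subspace_0 by (metis empty_subsetI insert_subset)
  moreover have "{v. v \<notin> U \<and> span (insert v U) \<in> polar} = (X \<inter> orth U) - U"
    using U by (auto simp: span_insert_in_polar_iff)
  moreover have "real (card ((X \<inter> orth U) - U)) = real (card (X \<inter> orth U)) - real CARD('a) ^ dim U"
    using polarD[OF U] card_mono[of "X \<inter> orth U" U]
    by (simp add: card_Diff_subset finite_vectors card_subspace of_nat_diff flip: of_nat_power)
  ultimately show ?thesis
    unfolding excess_def by (simp add: algebra_simps)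
qed

end

section \<open>The classical forms\<close>

context finite_vector_space
begin

text \<open>Every vector is isotropic for an alternating form, so each line is wholly singular and
  \<open>c\<close> is the order of the field.\<close>

lemma symplectic_reflexive_form:
  assumes "alternating_form f" "nondegenerate f"
  shows "reflexive_form scale Basis f UNIV CARD('a)"
    and "reflexive_form.polar scale f UNIV = totally_isotropic_subspaces f"
proof -
  have lin: "\<And>u. Vector_Spaces.linear scale (*) (\<lambda>v. f u v)"
      "\<And>v. Vector_Spaces.linear scale (*) (\<lambda>u. f u v)"
    and alt: "\<And>v. f v v = 0"
    using assms(1) by (auto simp: alternating_form_def bilinear_form_def)
  have add: "f u (v + w) = f u v + f u w" "f (v + w) u = f v u + f w u" for u v w
    using lin by (auto simp: Vector_Spaces.linear_iff)
  have skew: "f u v + f v u = 0" for u v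
    using alt[of "u + v"] alt[of u] alt[of v] by (simp add: add add.commute)
  show 1: "reflexive_form scale Basis f UNIV CARD('a)"
  proof (rule reflexive_form.intro[OF finite_vector_space_axioms reflexive_form_axioms.intro])
    show "f v u = 0" if "f u v = 0" for u v
      using that skew[of u v] by simp
    show "v = 0" if "\<And>w. f v w = 0" for v
      using that assms(2) unfolding nondegenerate_def by blast
  qed (simp_all add: lin alt)
  show "reflexive_form.polar scale f UNIV = totally_isotropic_subspaces f"
    unfolding reflexive_form.polar_def[OF 1] totally_isotropic_subspaces_def by blast
qed

lemma orthogonal_reflexive_form:
  assumes "quadratic_form g" "nonsingular g"
  shows "reflexive_form scale Basis (polar_form g) {v. g v = 0} 1"
    and "reflexive_form.polar scale (polar_form g) {v. g v = 0} = totally_singular_subspaces g"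
proof -
  have lin: "\<And>u. Vector_Spaces.linear scale (*) (\<lambda>v. polar_form g u v)"
      "\<And>v. Vector_Spaces.linear scale (*) (\<lambda>u. polar_form g u v)"
    and sc: "\<And>c v. g (scale c v) = c ^ 2 * g v"
    using assms(1) by (auto simp: quadratic_form_def bilinear_form_def)
  have scf: "polar_form g u (scale k v) = k * polar_form g u v" for u v k
    using lin by (auto simp: Vector_Spaces.linear_iff)
  have g0: "g 0 = 0" using sc[of 0 0] by simp
  have add: "g (u + v) = g u + g v + polar_form g u v" for u v
    by (simp add: polar_form_def)
  have sym: "polar_form g u v = polar_form g v u" for u v
    by (simp add: polar_form_def add.commute)
  \<comment> \<open>Evaluating \<open>g\<close> at \<open>v + v\<close> as a multiple of
    \<open>v\<close> works in every characteristic.\<close>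
  have self: "polar_form g v v = 0" if "g v = 0" for v
  proof -
    have "scale (1 + 1) v = v + v" by (simp only: scale_left_distrib scale_one)
    then show ?thesis using sc[of "1 + 1" v] that by (simp add: polar_form_def)
  qed
  have card1: "card {k. g (v + scale k x) = 0} = 1" if "g x = 0" "polar_form g v x \<noteq> 0" for v x
  proof -
    \<comment> \<open>As \<open>g x = 0\<close>, the restriction of \<open>g\<close> to the line is
      affine in \<open>k\<close> with nonzero slope, hence has one root.\<close>
    have "g (v + scale k x) = 0 \<longleftrightarrow> k = - g v / polar_form g v x" for k
      using that by (auto simp: add sc scf field_simps add_eq_0_iff)
    then show ?thesis by simp
  qed
  show 1: "reflexive_form scale Basis (polar_form g) {v. g v = 0} 1"
  proof (rule reflexive_form.intro[OF finite_vector_space_axioms reflexive_form_axioms.intro])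
    show "polar_form g v u = 0" if "polar_form g u v = 0" for u v
      using that sym[of v u] by simp
    show "v = 0" if "v \<in> {v. g v = 0}" "\<And>w. polar_form g v w = 0" for v
      using that assms(2) unfolding nonsingular_def by blast
    show "u + v \<in> {v. g v = 0}"
      if "u \<in> {v. g v = 0}" "v \<in> {v. g v = 0}" "polar_form g u v = 0" for u v
      using that by (simp add: add)
  qed (use lin(2) self g0 card1 sc in simp_all)
  have "polar_form g u v = 0" if "subspace U" "\<forall>u\<in>U. g u = 0" "u \<in> U" "v \<in> U" for U u v
    using that subspace_add[of U u v] by (simp add: polar_form_def)
  then show "reflexive_form.polar scale (polar_form g) {v. g v = 0} = totally_singular_subspaces g"
    unfolding reflexive_form.polar_def[OF 1] totally_singular_subspaces_def by blast
qed

end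

text \<open>In the Hermitian count this bounds both the fibres of \<open>z ^ q0 + z\<close> and the
  set of solutions of \<open>y ^ q0 = y\<close>.\<close>

lemma card_roots_monom_diff:
  fixes p :: "'a::field poly"
  assumes "degree p < n"
  shows "card {x. x ^ n = poly p x} \<le> n"
proof -
  let ?p = "monom 1 n - p"
  have d: "degree ?p = n" using assms
    by (simp add: degree_monom_eq degree_add_eq_left[of "- p" "monom 1 n", simplified])
  then have "?p \<noteq> 0" using assms by auto
  have "{x. x ^ n = poly p x} = {x. poly ?p x = 0}" by (simp add: poly_monom)
  then show ?thesis using card_poly_roots_bound[OF \<open>?p \<noteq> 0\<close>] d by simp
qed

context finite_vector_space
begin

lemma hermitian_reflexive_form:
  assumes "hermitian_form f" "nondegenerate f"
  obtains q\<^sub>0 where "q\<^sub>0 ^ 2 = CARD('a)"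
    and "reflexive_form scale Basis f {v. f v v = 0} q\<^sub>0"
    and "reflexive_form.polar scale f {v. f v v = 0} = totally_isotropic_subspaces f"
proof -
  obtain q0 where q0: "q0 ^ 2 = CARD('a)"
    and lin: "\<And>v. Vector_Spaces.linear scale (*) (\<lambda>u. f u v)"
    and sym: "\<And>u v. f v u = f u v ^ q0"
    using assms(1) unfolding hermitian_form_def by blast
  have add: "f (v + w) u = f v u + f w u" and sc: "f (scale k v) u = k * f v u" for u v w k
    using lin by (auto simp: Vector_Spaces.linear_iff)
  have q02: "1 < q0"
    using card_field_ge_2 q0 power_le_one[of q0 2] by (cases "1 < q0") auto
  have refl: "f v u = 0" if "f u v = 0" for u v
    using that sym[of v u] q02 by simp
  have "card {k. f (v + scale k x) (v + scale k x) = 0} = q0"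
    if x: "f x x = 0" "f v x \<noteq> 0" for v x
  proof -
    let ?h = "f v v" and ?g = "f x v"
    let ?\<phi> = "\<lambda>z. z ^ q0 + z - ?h"
    let ?F = "{y :: 'a. y ^ q0 = y}"
    have g: "?g \<noteq> 0" using x refl by blast
    \<comment> \<open>The substitution \<open>z = ?h + k * ?g\<close> makes the value of the form
      along the line a function of \<open>z\<close> alone.\<close>
    have norm: "f (v + scale k x) (v + scale k x) = ?\<phi> (?h + k * ?g)" for k
    proof -
      have "f v (v + scale k x) = (?h + k * ?g) ^ q0"
        using sym[of v "v + scale k x"] by (simp add: add sc)
      moreover have "f x (v + scale k x) = ?g"
        using sym[of x "v + scale k x"] sym[of x v] x by (simp add: add sc)
      ultimately show ?thesis by (simp add: add sc)
    qed
    \<comment> \<open>\<open>?\<phi>\<close> maps the \<open>q0\<^sup>2\<close> field elements to \<open>?F\<close>. As \<open>?F\<close> and all fibres of \<open>?\<phi>\<close> consist of roots of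
      polynomials of degree \<open>q0\<close>, each fibre over \<open>?F\<close> has exactly \<open>q0\<close> elements.\<close>
    have "?\<phi> z \<in> ?F" for z
    proof -
      \<comment> \<open>Here \<open>w\<close> is the point of the line with parameter
        \<open>z\<close>; Hermitian symmetry makes \<open>f w w\<close> its own power with exponent
        \<open>q0\<close>.\<close>
      define w where "w = v + scale ((z - ?h) / ?g) x"
      have "?\<phi> z = f w w" unfolding w_def norm using g by simp
      moreover have "f w w ^ q0 = f w w" by (rule sym[symmetric])
      ultimately show ?thesis by simp
    qed
    then have "(\<Sum>y\<in>?F. card {z. ?\<phi> z = y}) = CARD('a)"
      by (subst card_UN_disjoint[symmetric]) (auto intro: arg_cong[of _ _ card])
    moreover have fib: "card {z. ?\<phi> z = y} \<le> q0" for y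
      using card_roots_monom_diff[of "[:y + ?h, -1:]" q0] q02
      by (simp add: algebra_simps)
    moreover have "card ?F \<le> q0"
      using card_roots_monom_diff[of "[:0, 1:]" q0] q02 by simp
    ultimately have "\<not> (\<Sum>y\<in>?F. card {z. ?\<phi> z = y}) < (\<Sum>y\<in>?F. q0)"
      using q0 mult_le_mono1[of "card ?F" q0 q0] by (simp add: power2_eq_square not_less)
    moreover have "0 \<in> ?F" using q02 by simp
    moreover have "(\<Sum>y\<in>?F. card {z. ?\<phi> z = y}) < (\<Sum>y\<in>?F. q0)"
      if "card {z. ?\<phi> z = 0} < q0" "0 \<in> ?F"
      by (rule sum_strict_mono_ex1) (use fib that in \<open>auto intro!: exI[of _ 0]\<close>)
    ultimately have "\<not> card {z. ?\<phi> z = 0} < q0" by blast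
    then have "card {z. ?\<phi> z = 0} = q0" using fib[of 0] by simp
    moreover have "bij_betw (\<lambda>k. ?h + k * ?g) {k. f (v + scale k x) (v + scale k x) = 0} {z. ?\<phi> z = 0}"
      unfolding norm
      by (rule bij_betw_byWitness[where f' = "\<lambda>z. (z - ?h) / ?g"]) (use g in \<open>auto simp: add_diff_eq\<close>)
    ultimately show ?thesis by (simp add: bij_betw_same_card)
  qed
  moreover have "f (u + v) (u + v) = 0" if "f u u = 0" "f v v = 0" "f u v = 0" for u v
    using sym[of u "u + v"] sym[of v "u + v"] that refl[of u v] q02 by (simp add: add)
  moreover have "f (scale k v) (scale k v) = 0" if "f v v = 0" for k v
    using sym[of v "scale k v"] that q02 by (simp add: sc)
  moreover have "f 0 0 = 0" using sc[of 0 0 0] by simp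
  moreover have "v = 0" if "\<And>w. f v w = 0" for v
    using that assms(2) unfolding nondegenerate_def by blast
  ultimately have 1: "reflexive_form scale Basis f {v. f v v = 0} q0"
    using lin refl
    by (intro reflexive_form.intro[OF finite_vector_space_axioms reflexive_form_axioms.intro])
      simp_all
  have "reflexive_form.polar scale f {v. f v v = 0} = totally_isotropic_subspaces f"
    unfolding reflexive_form.polar_def[OF 1] totally_isotropic_subspaces_def by blast
  with q0 1 show thesis by (rule that)
qed

end

section \<open>Counting in polar spaces\<close>

text \<open>Reindexed by the dimension \<open>u\<close> of the spaces in a chain, the factors match
  those of \<open>card_superspaces\<close>.\<close>

lemma gaussian_binomial_diff:
  assumes "i \<le> t"
  shows "gaussian_binomial q (m - i) (t - i) =
    (\<Prod>u = i..<t. (real q ^ (m - u) - 1) / (real q ^ (t - u) - 1))"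
  unfolding gaussian_binomial_def
  by (rule prod.reindex_bij_witness[of _ "\<lambda>u. u - i" "\<lambda>j. j + i"]) (use assms in \<open>auto simp: add.commute\<close>)

lemma polar_binomial_diff:
  assumes "i \<le> t" "t \<le> r"
  shows "polar_binomial Q q (r - i) (t - i) =
    (\<Prod>u = i..<t. (real q ^ (r - u) - 1) / (real q ^ (t - u) - 1) *
      (real q powr (real r - real u + type_eps Q) + 1))"
proof -
  have "(\<Prod>j = (r - i) - (t - i) + 1..r - i. real q powr (real j + type_eps Q) + 1) =
      (\<Prod>u = i..<t. real q powr (real r - real u + type_eps Q) + 1)"
    by (rule prod.reindex_bij_witness[of _ "\<lambda>u. r - u" "\<lambda>j. r - j"]) (use assms in auto)
  then show ?thesis
    unfolding polar_binomial_def gaussian_binomial_diff[OF assms(1)] prod.distrib by simp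
qed

lemma power_diff_power:
  fixes x :: real
  assumes "u \<le> m"
  shows "x ^ m - x ^ u = x ^ u * (x ^ (m - u) - 1)"
  using assms by (simp add: right_diff_distrib flip: power_add)

context finite_vector_space
begin

text \<open>This is \<open>card_superspaces\<close> for the family of all subspaces of
  \<open>B\<close>, where a \<open>U\<close> is extended exactly by the vectors of
  \<open>B - U\<close>.\<close>

lemma card_intermediate_subspaces:
  assumes "subspace I" "subspace B" "I \<subseteq> B" "dim I \<le> t" "t \<le> dim B"
  shows "real (card {T. subspace T \<and> I \<subseteq> T \<and> T \<subseteq> B \<and> dim T = t}) =
    gaussian_binomial CARD('a) (dim B - dim I) (t - dim I)"
proof -
  let ?F = "{T. subspace T \<and> T \<subseteq> B}" and ?q = "real CARD('a)"
  have "real (card {v. v \<notin> U \<and> span (insert v U) \<in> ?F}) = ?q ^ dim B - ?q ^ dim U"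
    if U: "U \<in> ?F" for U
  proof -
    have "span (insert v U) \<subseteq> B \<longleftrightarrow> v \<in> B" for v
      using U assms(2) span_superset[of "insert v U"] span_minimal[of "insert v U" B] by auto
    then have "{v. v \<notin> U \<and> span (insert v U) \<in> ?F} = B - U" by auto
    then show ?thesis
      using U assms(2) card_mono[of B U]
      by (simp add: card_Diff_subset finite_vectors card_subspace of_nat_diff flip: of_nat_power)
  qed
  then have "real (card {T \<in> ?F. I \<subseteq> T \<and> dim T = t}) =
      (\<Prod>u = dim I..<t. (?q ^ dim B - ?q ^ u) / (?q ^ t - ?q ^ u))"
    by (intro card_superspaces) (use assms in auto)
  also have "\<dots> = (\<Prod>u = dim I..<t. (?q ^ (dim B - u) - 1) / (?q ^ (t - u) - 1))"
    using assms(5) by (intro prod.cong) (simp_all add: power_diff_power)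
  also have "\<dots> = gaussian_binomial CARD('a) (dim B - dim I) (t - dim I)"
    using assms(4) by (simp add: gaussian_binomial_diff)
  also have "{T \<in> ?F. I \<subseteq> T \<and> dim T = t} = {T. subspace T \<and> I \<subseteq> T \<and> T \<subseteq> B \<and> dim T = t}"
    by auto
  finally show ?thesis .
qed

end

text \<open>Write \<open>c\<close> as the field order to the power \<open>d\<close>, with
  \<open>d\<close> equal to 1, 1/2 or 0 for symplectic, Hermitian or orthogonal forms. All six types
  then satisfy \<open>d + n = 2 * r + 1 + type_eps Q\<close>, where \<open>n\<close> is the ambient
  dimension.\<close>

lemma (in classical_polar_space) obtain_reflexive_form:
  obtains f X c where "reflexive_form scale Basis f X c"
    and "P = reflexive_form.polar scale f X"
    and "real c * real CARD('a) ^ dim (UNIV :: 'v set) / real CARD('a) ^ Suc r =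
      real CARD('a) powr (real r + type_eps Q)"
proof -
  interpret finite_vector_space scale Basis by unfold_locales
  let ?q = "real CARD('a)"
  have q: "?q > 0" by simp
  have exponent: "?q powr d * ?q ^ n / ?q ^ Suc r = ?q powr (real r + type_eps Q)"
    if "d + real n = 2 * real r + 1 + type_eps Q" for d n
  proof -
    have "?q powr d * ?q ^ n / ?q ^ Suc r = ?q powr (d + real n - real (Suc r))"
      using q by (simp only: powr_add powr_diff powr_realpow)
    also have "d + real n - real (Suc r) = real r + type_eps Q" using that by simp
    finally show ?thesis .
  qed
  note result = that
  have hermitian: thesis if P: "hermitian_polar_space P"
    and n: "1 / 2 + real (dim (UNIV :: 'v set)) = 2 * real r + 1 + type_eps Q"
  proof -
    from P obtain g where g: "hermitian_form g" "nondegenerate g"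
        "P = totally_isotropic_subspaces g"
      unfolding hermitian_polar_space_def by blast
    from g(1,2) obtain q0 where q0: "q0 ^ 2 = CARD('a)"
      "reflexive_form scale Basis g {v. g v v = 0} q0"
      "reflexive_form.polar scale g {v. g v v = 0} = totally_isotropic_subspaces g"
      by (rule hermitian_reflexive_form)
    have c: "real q0 = ?q powr (1 / 2)"
      unfolding q0(1)[symmetric] by (simp add: powr_half_sqrt)
    show thesis
      by (rule result[OF q0(2)]) (simp_all only: g(3) q0(3) c exponent[OF n])
  qed
  have orthogonal: thesis if P: "orthogonal_polar_space P"
    and n: "0 + real (dim (UNIV :: 'v set)) = 2 * real r + 1 + type_eps Q"
  proof -
    from P obtain g where g: "quadratic_form g" "nonsingular g"
        "P = totally_singular_subspaces g"
      unfolding orthogonal_polar_space_def by blast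
    have c: "real 1 = ?q powr 0" by simp
    note form = orthogonal_reflexive_form[OF g(1,2)]
    show thesis
      by (rule result[OF form(1)]) (simp_all only: g(3) form(2) c exponent[OF n])
  qed
  have symplectic: thesis if P: "symplectic_polar_space P"
    and n: "1 + real (dim (UNIV :: 'v set)) = 2 * real r + 1 + type_eps Q"
  proof -
    from P obtain g where g: "alternating_form g" "nondegenerate g"
        "P = totally_isotropic_subspaces g"
      unfolding symplectic_polar_space_def by blast
    have e: "?q * ?q ^ dim (UNIV :: 'v set) / ?q ^ Suc r = ?q powr (real r + type_eps Q)"
      using exponent[OF n] by (simp only: powr_one q less_imp_le)
    note form = symplectic_reflexive_form[OF g(1,2)]
    show thesis
      by (rule result[OF form(1)]) (simp_all only: g(3) form(2) e)
  qed
  show thesis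
    using kind dimension hermitian orthogonal symplectic by (cases Q) (simp_all del: dim_UNIV)
qed

lemma (in classical_polar_space) card_superspaces_in_polar_space:
  assumes I: "I \<in> P" "dim I \<le> t" and t: "t \<le> r"
  shows "real (card {T \<in> P. I \<subseteq> T \<and> dim T = t}) =
    polar_binomial Q CARD('a) (r - dim I) (t - dim I)"
proof -
  interpret finite_vector_space scale Basis by unfold_locales
  let ?q = "real CARD('a)"
  have q: "?q > 0" by simp
  obtain f X c where form: "reflexive_form scale Basis f X c"
    and P: "P = reflexive_form.polar scale f X"
    and c: "real c * ?q ^ dim (UNIV :: 'v set) / ?q ^ Suc r = ?q powr (real r + type_eps Q)"
    by (rule obtain_reflexive_form)
  interpret reflexive_form scale Basis f X c by (rule form)
  define ext where "ext u = ?q ^ r - ?q ^ u +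
      real c * ?q ^ dim (UNIV :: 'v set) * (1 / ?q ^ Suc u - 1 / ?q ^ Suc r)" for u
  have "real (card {T \<in> P. I \<subseteq> T \<and> dim T = t}) =
      (\<Prod>u = dim I..<t. ext u / (?q ^ t - ?q ^ u))"
    unfolding P
  proof (rule card_superspaces)
    show "real (card {v. v \<notin> U \<and> span (insert v U) \<in> polar}) = ext (dim U)"
      if "U \<in> polar" for U
      unfolding ext_def using card_extensions[OF that] rank P by simp
    show "I \<in> polar" using I(1) P by simp
  qed (fact polarD(1) polar_subspace I(2))+
  also have "\<dots> = (\<Prod>u = dim I..<t. (?q ^ (r - u) - 1) / (?q ^ (t - u) - 1) *
      (?q powr (real r - real u + type_eps Q) + 1))"
  proof (rule prod.cong[OF refl])
    fix u assume u: "u \<in> {dim I..<t}"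
    \<comment> \<open>Both summands become multiples of \<open>?q ^ (r - u) - 1\<close>, and the
      second acquires the constant evaluated in \<open>c\<close>; this yields the factor of the
      polar binomial.\<close>
    have "ext u = (?q ^ r - ?q ^ u) +
        real c * ?q ^ dim (UNIV :: 'v set) / ?q ^ Suc r * (?q ^ (r - u) - 1)"
      using u t unfolding ext_def by (simp add: power_diff field_simps)
    also have "\<dots> = (?q ^ r - ?q ^ u) + ?q powr (real r + type_eps Q) * (?q ^ (r - u) - 1)"
      by (simp only: c)
    also have "?q powr (real r + type_eps Q) = ?q ^ u * ?q powr (real r - real u + type_eps Q)"
      using q by (simp flip: powr_realpow powr_add)
    finally have "ext u = ?q ^ u * (?q ^ (r - u) - 1) * (?q powr (real r - real u + type_eps Q) + 1)"
      using u t power_diff_power[of u r ?q] by (simp add: algebra_simps)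
    moreover have "?q ^ t - ?q ^ u = ?q ^ u * (?q ^ (t - u) - 1)"
      using u by (intro power_diff_power) simp
    ultimately show "ext u / (?q ^ t - ?q ^ u) = (?q ^ (r - u) - 1) / (?q ^ (t - u) - 1) *
      (?q powr (real r - real u + type_eps Q) + 1)"
      by simp
  qed
  also have "\<dots> = polar_binomial Q CARD('a) (r - dim I) (t - dim I)"
    using I t by (simp add: polar_binomial_diff)
  finally show ?thesis .
qed

lemma (in classical_polar_space) subspace_in_polar_space:
  assumes "T \<in> P"
  shows "subspace T" and "\<And>U. subspace U \<Longrightarrow> U \<subseteq> T \<Longrightarrow> U \<in> P"
proof -
  obtain f X c where form: "reflexive_form scale Basis f X c"
    and P: "P = reflexive_form.polar scale f X"
    by (rule obtain_reflexive_form)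
  show "subspace T" "\<And>U. subspace U \<Longrightarrow> U \<subseteq> T \<Longrightarrow> U \<in> P"
    using assms reflexive_form.polarD(1)[OF form] reflexive_form.polar_subspace[OF form]
    unfolding P by blast+
qed

section \<open>Intersection numbers of a design with a fixed subspace\<close>

lemma gaussian_binomial_pos:
  assumes "q \<ge> 2" "k \<le> m"
  shows "gaussian_binomial q m k > 0"
  unfolding gaussian_binomial_def using assms
  by (intro prod_pos ballI divide_pos_pos) (auto simp: one_less_power)

theorem theorem11:
  fixes scale :: "'a::{field, finite} \<Rightarrow> 'v::ab_group_add \<Rightarrow> 'v"
    and Basis :: "'v set" and Q :: polar_type and P D :: "'v set set" and S :: "'v set"
    and q r t k l s i :: nat and \<alpha> :: "nat \<Rightarrow> nat" and l\<^sub>i :: real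
  assumes "classical_polar_space scale Basis Q r P"
    and "q = CARD('a)"
    and "1 \<le> r" and "t \<le> k" and "k \<le> r"
    and "finite_field_vector_space.polar_design scale P t k l D"
    and "S \<in> P" and "s = vector_space.dim scale S"
    and "\<And>j. \<alpha> j = card {B \<in> D. vector_space.dim scale (B \<inter> S) = j}"
    and "i \<le> t"
    and "l\<^sub>i = real l * (polar_binomial Q q (r - i) (t - i) / gaussian_binomial q (k - i) (t - i))"
  shows "(\<Sum>j = i..s. gaussian_binomial q j i * real (\<alpha> j)) = gaussian_binomial q s i * l\<^sub>i"
proof -
  interpret classical_polar_space scale Basis Q r P by fact
  interpret finite_vector_space scale Basis by unfold_locales
  note q = \<open>q = CARD('a)\<close> and S = \<open>S \<in> P\<close> and s = \<open>s = dim S\<close>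
  note fd = finite_dimensional_vector_space_axioms
  have D: "D \<subseteq> P" "\<And>B. B \<in> D \<Longrightarrow> dim B = k"
    and design: "\<And>U. U \<in> P \<Longrightarrow> dim U = t \<Longrightarrow> card {B \<in> D. U \<subseteq> B} = l"
    using \<open>polar_design P t k l D\<close> by (auto simp: polar_design_def)
  have index: "real (card {B \<in> D. I \<subseteq> B}) = l\<^sub>i" if I: "I \<in> P" "dim I = i" for I
  proof -
    let ?T = "{T \<in> P. I \<subseteq> T \<and> dim T = t}"
    have pos: "gaussian_binomial q (k - i) (t - i) > 0"
      using card_field_ge_2 \<open>t \<le> k\<close> by (intro gaussian_binomial_pos) (auto simp: q)
    have "real (card {T \<in> ?T. T \<subseteq> B}) = gaussian_binomial q (k - i) (t - i)"
      if B: "B \<in> {B \<in> D. I \<subseteq> B}" for B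
    proof -
      have BP: "B \<in> P" "dim B = k" "I \<subseteq> B" using B D by auto
      have "{T \<in> ?T. T \<subseteq> B} = {T. subspace T \<and> I \<subseteq> T \<and> T \<subseteq> B \<and> dim T = t}"
        using subspace_in_polar_space BP(1) by blast
      then show ?thesis
        using card_intermediate_subspaces[of I B t] subspace_in_polar_space(1) BP I
          \<open>t \<le> k\<close> \<open>i \<le> t\<close> by (simp add: q)
    qed
    then have "real (card {B \<in> D. I \<subseteq> B}) * gaussian_binomial q (k - i) (t - i) =
        real (\<Sum>B\<in>{B \<in> D. I \<subseteq> B}. card {T \<in> ?T. T \<subseteq> B})"
      by simp
    \<comment> \<open>Blocks through a \<open>T\<close> above \<open>I\<close> contain
      \<open>I\<close> automatically, so the design property applies to each
      \<open>T\<close>.\<close>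
    also have "(\<Sum>B\<in>{B \<in> D. I \<subseteq> B}. card {T \<in> ?T. T \<subseteq> B}) = (\<Sum>T\<in>?T. l)"
    proof (rule sum_multicount_gen)
      have "{B \<in> {B \<in> D. I \<subseteq> B}. T \<subseteq> B} = {B \<in> D. T \<subseteq> B}" if "T \<in> ?T" for T
        using that by auto
      then show "\<forall>T\<in>?T. card {B \<in> {B \<in> D. I \<subseteq> B}. T \<subseteq> B} = l"
        using design by auto
    qed auto
    also have "real \<dots> = real l * polar_binomial Q q (r - i) (t - i)"
      using card_superspaces_in_polar_space[of I t] I \<open>i \<le> t\<close> \<open>t \<le> k\<close> \<open>k \<le> r\<close> by (simp add: q)
    finally show ?thesis
      using pos unfolding assms(11) times_divide_eq_right by (simp add: nonzero_eq_divide_eq)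
  qed
  let ?I = "{I. subspace I \<and> I \<subseteq> S \<and> dim I = i}"
  have sub: "subspace (B \<inter> S)" if "B \<in> D" for B
    using that D(1) S subspace_in_polar_space(1) by (auto intro: subspace_inter)
  have card_I: "real (card {I \<in> ?I. I \<subseteq> B}) = gaussian_binomial q (dim (B \<inter> S)) i" if "B \<in> D" for B
  proof -
    have "{I \<in> ?I. I \<subseteq> B} = {I. subspace I \<and> I \<subseteq> B \<inter> S \<and> dim I = i}" by auto
    then show ?thesis
      using card_subspaces_eq_gaussian_binomial[OF fd sub[OF that], of i] by (simp add: q)
  qed
  \<comment> \<open>The factor with index \<open>j\<close> has numerator \<open>q ^ 0 - 1\<close>.
    The sum may therefore start at 0, so that every block is counted.\<close>
  have small: "gaussian_binomial q j i = 0" if "j < i" for j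
    using that by (auto simp: gaussian_binomial_def intro!: bexI[of _ j])
  have "(\<Sum>j = i..s. gaussian_binomial q j i * real (\<alpha> j)) =
      (\<Sum>j\<le>s. gaussian_binomial q j i * real (\<alpha> j))"
    by (rule sum.mono_neutral_left) (auto simp: small)
  also have "\<dots> = (\<Sum>j\<le>s. \<Sum>B\<in>{B \<in> D. dim (B \<inter> S) = j}. gaussian_binomial q (dim (B \<inter> S)) i)"
    using assms(9) by (intro sum.cong) auto
  \<comment> \<open>The classes of blocks with \<open>dim (B \<inter> S) = j\<close> exhaust
    \<open>D\<close>, because this dimension is at most \<open>s\<close>.\<close>
  also have "\<dots> = (\<Sum>B\<in>D. gaussian_binomial q (dim (B \<inter> S)) i)"
    by (rule sum.group) (auto simp: s intro: dim_subset)
  also have "\<dots> = real (\<Sum>B\<in>D. card {I \<in> ?I. I \<subseteq> B})"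
    using card_I by simp
  also have "(\<Sum>B\<in>D. card {I \<in> ?I. I \<subseteq> B}) = (\<Sum>I\<in>?I. card {B \<in> D. I \<subseteq> B})"
    by (rule sum_multicount_gen) auto
  also have "real \<dots> = (\<Sum>I\<in>?I. l\<^sub>i)"
    unfolding of_nat_sum using subspace_in_polar_space(2)[OF S] by (intro sum.cong index) auto
  also have "\<dots> = gaussian_binomial q s i * l\<^sub>i"
    using card_subspaces_eq_gaussian_binomial[OF fd subspace_in_polar_space(1)[OF S], of i]
    by (simp add: q s)
  finally show ?thesis .
qed

end
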